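(* Let $A \in \mathbb{R}^{n \times n}$ (possibly singular), let $A = M - N$ with $M \in \mathbb{R}^{n\times n}$ nonsingular, let $H = M^{-1} N$, and for $\ell \in \mathbb{N}$ ($\ell \ge 1$) let $C^{(\ell)} = \sum_{i=0}^{\ell-1} H^i M^{-1}$. Assume that $H$ is semiconvergent. Then GMRES preconditioned (from the right) by $C^{(\ell)}$ determines a solution of $A \boldsymbol{x} = \boldsymbol{b}$ without breakdown for all $\boldsymbol{b} \in \mathcal{R}(A)$, for all $\boldsymbol{x}_0 \in \mathbb{R}^n$, and for all $\ell \in \mathbb{N}$.
   Context: $\mathcal{R}(\cdot)$ denotes the range and $\|\cdot\|$ the Euclidean norm. A square real matrix $H$ is semiconvergent if $\lim_{i\to\infty} H^i$ exists. For a square matrix $B$ and vector $\boldsymbol{r}$, $\mathcal{K}_k(B, \boldsymbol{r}) = \mathrm{span}\{\boldsymbol{r}, B\boldsymbol{r}, \dots, B^{k-1}\boldsymbol{r}\}$. GMRES preconditioned by $C = C^{(\ell)}$ with initial iterate $\boldsymbol{x}_0$ is GMRES applied to $AC\boldsymbol{u} = \boldsymbol{b}$, $\boldsymbol{x} = C\boldsymbol{u}$: with $\boldsymbol{r}_0 = \boldsymbol{b} - A\boldsymbol{x}_0$, its $k$th iterate $\boldsymbol{x}_k$ is a minimizer of $\|\boldsymbol{b} - A\boldsymbol{x}\|$ over $\boldsymbol{x} \in \boldsymbol{x}_0 + C\,\mathcal{K}_k(AC, \boldsymbol{r}_0) = \boldsymbol{x}_0 + \mathcal{K}_k(CA, C\boldsymbol{r}_0)$.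 The method breaks down at step $k$ if $\dim \big(AC\,\mathcal{K}_k(AC,\boldsymbol{r}_0)\big) < \dim \mathcal{K}_k(AC,\boldsymbol{r}_0)$ or $\dim \mathcal{K}_k(AC,\boldsymbol{r}_0) < k$. "Determines a solution without breakdown" means that there is $k \ge 0$ such that no breakdown occurs at steps $1, \dots, k$ and $A\boldsymbol{x}_k = \boldsymbol{b}$. *)

theory Defs
  imports "HOL-Analysis.Analysis"
begin

(* The library multiplication (and hence the power ^) on real ^ 'n ^ 'n is componentwise,
   so the matrix power has to be defined through the matrix product **. *)
primrec mat_power :: "real ^ 'n ^ 'n \<Rightarrow> nat \<Rightarrow> real ^ 'n ^ 'n" where
  "mat_power B 0 = mat 1"
| "mat_power B (Suc i) = B ** mat_power B i"

definition semiconvergent :: "real ^ 'n ^ 'n \<Rightarrow> bool" where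
  "semiconvergent H \<longleftrightarrow> convergent (\<lambda>i. mat_power H i)"

definition inner_iter_precond :: "real ^ 'n ^ 'n \<Rightarrow> real ^ 'n ^ 'n \<Rightarrow> nat \<Rightarrow> real ^ 'n ^ 'n" where
  "inner_iter_precond M H l = (\<Sum>i<l. mat_power H i ** matrix_inv M)"

definition krylov :: "real ^ 'n ^ 'n \<Rightarrow> real ^ 'n \<Rightarrow> nat \<Rightarrow> (real ^ 'n) set" where
  "krylov B r k = span ((\<lambda>i. mat_power B i *v r) ` {..<k})"

(* A minimizer of the residual norm over x0 + C K_k(AC, r0), with r0 = b - A x0.
   This is a relation because the minimizer need not be unique after a breakdown. *)
definition gmres_iterate ::
  "real ^ 'n ^ 'n \<Rightarrow> real ^ 'n ^ 'n \<Rightarrow> real ^ 'n \<Rightarrow> real ^ 'n \<Rightarrow> nat \<Rightarrow> real ^ 'n \<Rightarrow> bool" where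
  "gmres_iterate A C b x0 k x \<longleftrightarrow>
     is_arg_min (\<lambda>y. norm (b - A *v y))
       (\<lambda>y. y \<in> {x0 + C *v u | u. u \<in> krylov (A ** C) (b - A *v x0) k}) x"

definition gmres_breakdown ::
  "real ^ 'n ^ 'n \<Rightarrow> real ^ 'n ^ 'n \<Rightarrow> real ^ 'n \<Rightarrow> real ^ 'n \<Rightarrow> nat \<Rightarrow> bool" where
  "gmres_breakdown A C b x0 k \<longleftrightarrow>
     (let K = krylov (A ** C) (b - A *v x0) k
      in dim ((\<lambda>v. (A ** C) *v v) ` K) < dim K \<or> dim K < k)"

(* The k-th iterate must exist, and every admissible choice of it must be a solution. *)
definition gmres_determines_solution ::
  "real ^ 'n ^ 'n \<Rightarrow> real ^ 'n ^ 'n \<Rightarrow> real ^ 'n \<Rightarrow> real ^ 'n \<Rightarrow> bool" where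
  "gmres_determines_solution A C b x0 \<longleftrightarrow>
     (\<exists>k. (\<forall>j\<in>{1..k}. \<not> gmres_breakdown A C b x0 j) \<and>
          (\<exists>x. gmres_iterate A C b x0 k x) \<and>
          (\<forall>x. gmres_iterate A C b x0 k x \<longrightarrow> A *v x = b))"

end

(* Put B = A C.  With y = M^-1 v one has B v = M (y - H^l y), and v lies in R(A) iff y lies in
   R(I - H).  If H is semiconvergent and y = z - H z, then H^i y tends to 0; so H^l y = y
   forces y = 0, that is, B is injective on R(A), which is B-invariant and contains r0.
   Let k be the first index with B^k r0 in K_k.  Up to step k the Krylov spaces grow by one
   dimension each and B preserves their dimension, so there is no breakdown; K_k is
   B-invariant, hence B K_k = K_k contains r0 and the k-th residual vanishes. *)
theory Submission
  imports Defs
begin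

text \<open>Passing to iterates of a map gives access to \<open>funpow_add\<close> and
  \<open>funpow_Suc_right\<close>, hence to powers that split and commute with
  \<open>B\<close>.\<close>

lemma mat_power_mult_vec: "mat_power B i *v x = (((*v) B) ^^ i) x"
  by (induction i) (auto simp: matrix_vector_mul_assoc[symmetric])

lemma krylov_Suc: "krylov B r (Suc k) = span (insert (mat_power B k *v r) (krylov B r k))"
  by (simp add: krylov_def lessThan_Suc span_insert span_span)

text \<open>Multiplication by \<open>B\<close> shifts each generator to the next one, and a linear
  map sends spans to spans.\<close>

lemma krylov_mult_vec:
  assumes "v \<in> krylov B r k"
  shows "B *v v \<in> krylov B r (Suc k)"
proof -
  have "(*v) B ` krylov B r k = span ((*v) B ` (\<lambda>i. mat_power B i *v r) ` {..<k})"
    unfolding krylov_def by (simp add: linear_span_image)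
  also have "\<dots> = span ((\<lambda>i. mat_power B (Suc i) *v r) ` {..<k})"
    by (simp add: image_image matrix_vector_mul_assoc)
  also have "\<dots> \<subseteq> krylov B r (Suc k)"
    unfolding krylov_def by (intro span_mono) blast
  finally show ?thesis using assms by blast
qed

lemma dim_krylov_Suc:
  assumes "mat_power B k *v r \<notin> krylov B r k"
  shows "dim (krylov B r (Suc k)) = Suc (dim (krylov B r k))"
  using assms unfolding krylov_Suc dim_span dim_insert by (simp add: krylov_def span_span)

text \<open>\<open>B\<close> may be singular on the whole space; a trivial kernel on an invariant
  subspace \<open>V\<close> suffices, because \<open>V\<close> contains every Krylov space of
  \<open>r\<close>. The two dimension claims rule out the two forms of breakdown.\<close>

lemma krylov_solves:
  fixes B :: "real ^ 'n ^ 'n"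
  assumes V: "subspace V" "r \<in> V"
    and inv: "\<And>v. v \<in> V \<Longrightarrow> B *v v \<in> V"
    and inj: "\<And>v. v \<in> V \<Longrightarrow> B *v v = 0 \<Longrightarrow> v = 0"
  obtains k where "\<And>j. j \<le> k \<Longrightarrow> dim (krylov B r j) = j"
    and "\<And>j. j \<le> k \<Longrightarrow> dim ((*v) B ` krylov B r j) = j"
    and "r \<in> (*v) B ` krylov B r k"
proof -
  define P where "P k \<longleftrightarrow> mat_power B k *v r \<in> krylov B r k" for k
  have dim_eq: "dim (krylov B r j) = j" if "\<And>i. i < j \<Longrightarrow> \<not> P i" for j
    using that
  proof (induction j)
    case 0
    then show ?case by (simp add: krylov_def)
  next
    case (Suc j)
    then show ?case using dim_krylov_Suc[of B j r] by (auto simp: P_def)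
  qed
  have "\<exists>k. P k"
  proof (rule ccontr)
    assume "\<nexists>k. P k"
    \<comment> \<open>If the Krylov spaces grew forever, one of them would exceed the dimension of
      the ambient space.\<close>
    then have "dim (krylov B r (Suc CARD('n))) = Suc CARD('n)"
      by (intro dim_eq) blast
    with dim_subset_UNIV_cart[of "krylov B r (Suc CARD('n))"] show False by simp
  qed
  \<comment> \<open>By minimality \<open>P\<close> fails at every index below \<open>k\<close>.
    Since \<open>dim_eq\<close> asks only about indices strictly below \<open>j\<close>, it still
    covers \<open>j = k\<close>.\<close>
  define k where "k = (LEAST k. P k)"
  have Pk: "P k" unfolding k_def using \<open>\<exists>k. P k\<close> by (rule LeastI_ex)
  have dimK: "dim (krylov B r j) = j" if "j \<le> k" for j
    using that by (intro dim_eq) (metis k_def not_less_Least order_less_le_trans)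
  have KV: "krylov B r j \<subseteq> V" for j
  proof -
    have "mat_power B i *v r \<in> V" for i
      by (induction i) (auto simp: V inv matrix_vector_mul_assoc[symmetric])
    then show ?thesis unfolding krylov_def using V by (intro span_minimal) auto
  qed
  have sub: "subspace (krylov B r j)" for j by (simp add: krylov_def)
  have dimB: "dim ((*v) B ` krylov B r j) = dim (krylov B r j)" for j
  proof (rule dim_image_eq)
    have "inj_on ((*v) B) (krylov B r j)"
      unfolding linear_inj_on_iff_eq_0[OF matrix_vector_mul_linear sub]
      using KV inj by blast
    then show "inj_on ((*v) B) (span (krylov B r j))"
      by (simp only: span_eq_iff[THEN iffD2, OF sub])
  qed simp
  \<comment> \<open>The new generator already lies in the space, so the growth stops and the space
    is invariant under \<open>B\<close>. Equality of dimensions then turns inclusion of the image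
    into equality.\<close>
  have "krylov B r (Suc k) = krylov B r k"
    using Pk by (simp only: krylov_Suc P_def insert_absorb span_eq_iff[THEN iffD2, OF sub])
  then have "(*v) B ` krylov B r k \<subseteq> krylov B r k"
    using krylov_mult_vec by blast
  then have onto: "(*v) B ` krylov B r k = krylov B r k"
    using sub dimB by (intro subspace_dim_equal) (auto intro: linear_subspace_image)
  have "r \<in> krylov B r k"
  \<comment> \<open>For \<open>k = 0\<close> there are no generators, and membership of
    \<open>r\<close> comes from \<open>P 0\<close>, which forces \<open>r = 0\<close>; otherwise
    \<open>r\<close> is the first generator.\<close>
  proof (cases k)
    case 0
    then show ?thesis using Pk by (simp add: P_def)
  next
    case (Suc m)
    then have "mat_power B 0 *v r \<in> krylov B r k"
      unfolding krylov_def by (intro span_base imageI) simp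
    then show ?thesis by simp
  qed
  then show thesis using that[of k] dimK dimB onto by simp
qed

text \<open>The subspace for \<open>krylov_solves\<close> is the range of \<open>A\<close>: it is
  invariant because \<open>A\<close> is applied last, and it contains the initial residual because
  the system is consistent.\<close>

lemma gmres_determines_solution_if_inj_on_range:
  fixes A C :: "real ^ 'n ^ 'n"
  assumes b: "b \<in> range ((*v) A)"
    and inj: "\<And>v. v \<in> range ((*v) A) \<Longrightarrow> (A ** C) *v v = 0 \<Longrightarrow> v = 0"
  shows "gmres_determines_solution A C b x0"
proof -
  define r where "r = b - A *v x0"
  define V where "V = range ((*v) A)"
  have "subspace V" unfolding V_def by (intro linear_subspace_image) auto
  moreover have "r \<in> V"
    using b by (auto simp: r_def V_def matrix_vector_mult_diff_distrib[symmetric])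
  moreover have "(A ** C) *v v \<in> V" for v
    by (simp add: V_def matrix_vector_mul_assoc[symmetric])
  ultimately obtain k where k:
      "\<And>j. j \<le> k \<Longrightarrow> dim (krylov (A ** C) r j) = j"
      "\<And>j. j \<le> k \<Longrightarrow> dim ((*v) (A ** C) ` krylov (A ** C) r j) = j"
      "r \<in> (*v) (A ** C) ` krylov (A ** C) r k"
    using krylov_solves[of V r "A ** C"] inj unfolding V_def by blast
  then obtain u where u: "u \<in> krylov (A ** C) r k" "(A ** C) *v u = r" by auto
  have sol: "A *v (x0 + C *v u) = b"
    using u(2) by (simp add: matrix_vector_right_distrib matrix_vector_mul_assoc r_def)
  have "\<not> gmres_breakdown A C b x0 j" if "j \<in> {1..k}" for j
    using k that by (simp add: gmres_breakdown_def r_def)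
  moreover have "gmres_iterate A C b x0 k (x0 + C *v u)"
    using u(1) sol unfolding gmres_iterate_def is_arg_min_def r_def by auto
  moreover have "A *v x = b" if "gmres_iterate A C b x0 k x" for x
  proof -
    \<comment> \<open>The candidate built from \<open>u\<close> has residual zero, so every
      minimizer must have residual zero too.\<close>
    have "\<not> norm (b - A *v (x0 + C *v u)) < norm (b - A *v x)"
      using that u(1) unfolding gmres_iterate_def is_arg_min_def r_def by blast
    then show ?thesis by (simp add: sol)
  qed
  ultimately show ?thesis unfolding gmres_determines_solution_def by blast
qed

lemma semiconvergent_convergent_vec:
  assumes "semiconvergent H"
  shows "convergent (\<lambda>i. mat_power H i *v z)"
proof -
  obtain P where "(\<lambda>i. mat_power H i) \<longlonglongrightarrow> P"
    using assms by (auto simp: semiconvergent_def convergent_def)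
  then have "(\<lambda>i. mat_power H i *v z) \<longlonglongrightarrow> P *v z"
    unfolding matrix_vector_mult_def by (intro tendsto_intros)
  then show ?thesis by (auto simp: convergent_def)
qed

text \<open>The terms are differences of consecutive members of the convergent sequence
  \<open>mat_power H i *v z\<close>.\<close>

lemma mat_power_diff_tendsto_0:
  assumes "semiconvergent H"
  shows "(\<lambda>i. mat_power H i *v (z - H *v z)) \<longlonglongrightarrow> 0"
proof -
  obtain p where p: "(\<lambda>i. mat_power H i *v z) \<longlonglongrightarrow> p"
    using semiconvergent_convergent_vec[OF assms] by (auto simp: convergent_def)
  have "mat_power H i *v (z - H *v z) = mat_power H i *v z - mat_power H (Suc i) *v z" for i
    unfolding matrix_vector_mult_diff_distrib unfolding mat_power_mult_vec funpow_Suc_right by simp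
  then show ?thesis
    using tendsto_diff[OF p LIMSEQ_Suc[OF p]] by simp
qed

text \<open>A vector fixed by the \<open>l\<close>-th power is fixed by all powers with exponent
  \<open>l * m\<close>. Along this subsequence, strictly increasing as \<open>l\<close> is positive,
  the powers applied to \<open>y\<close> are constant and yet tend to 0.\<close>

lemma semiconvergent_fixed_range_eq_0:
  assumes "semiconvergent H" and "l \<ge> 1"
    and y: "y = z - H *v z" and fixed: "mat_power H l *v y = y"
  shows "y = 0"
proof -
  have "mat_power H (l * m) *v y = y" for m
    using fixed unfolding mat_power_mult_vec by (induction m) (auto simp: funpow_add)
  moreover have "(\<lambda>m. mat_power H (l * m) *v y) \<longlonglongrightarrow> 0"
    using LIMSEQ_subseq_LIMSEQ[OF mat_power_diff_tendsto_0[OF assms(1)], of "\<lambda>m. l * m" z] \<open>l \<ge> 1\<close>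
    by (simp add: y strict_mono_def o_def)
  ultimately show ?thesis by (simp add: LIMSEQ_const_iff)
qed

lemma sum_matrix_vector_mult:
  fixes f :: "'a \<Rightarrow> real ^ 'n ^ 'm"
  shows "(\<Sum>i\<in>S. f i) *v x = (\<Sum>i\<in>S. f i *v x)"
  by (induction S rule: infinite_finite_induct) (auto simp: matrix_vector_mult_add_rdistrib)

lemma matrix_inv_mult:
  fixes M :: "'a::semiring_1 ^ 'n ^ 'm"
  assumes "invertible M"
  shows "M ** matrix_inv M = mat 1" and "matrix_inv M ** M = mat 1"
  using someI_ex[OF assms[unfolded invertible_def]] by (auto simp: matrix_inv_def)

text \<open>The factor \<open>M\<close> cancels the inverse inside the preconditioner, leaving a
  geometric sum in \<open>H\<close> that telescopes under I - H.\<close>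

lemma inner_iter_precond_telescope:
  fixes M H :: "real ^ 'n ^ 'n"
  assumes "invertible M"
    and w_def: "w = inner_iter_precond M H l *v (M *v y)"
  shows "w - H *v w = y - mat_power H l *v y"
proof -
  have "matrix_inv M *v (M *v y) = y"
    using assms(1) by (simp add: matrix_vector_mul_assoc matrix_inv_mult)
  then have w: "w = (\<Sum>i<l. mat_power H i *v y)"
    unfolding w_def inner_iter_precond_def
    by (simp add: sum_matrix_vector_mult matrix_vector_mul_assoc[symmetric])
  have "H *v w = (\<Sum>i<l. mat_power H (Suc i) *v y)"
    unfolding w by (simp add: linear_sum[OF matrix_vector_mul_linear] matrix_vector_mul_assoc)
  then show ?thesis
    unfolding w using sum_lessThan_telescope'[of "\<lambda>i. mat_power H i *v y" l]
    by (simp add: sum_subtractf del: mat_power.simps(2))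
qed

theorem theorem2p4:
  fixes A M N H :: "real ^ 'n ^ 'n"
  assumes "A = M - N"
    and "invertible M"
    and "H = matrix_inv M ** N"
    and "semiconvergent H"
  shows "\<forall>b \<in> range (\<lambda>x. A *v x). \<forall>x0. \<forall>l\<ge>1.
           gmres_determines_solution A (inner_iter_precond M H l) b x0"
proof (intro ballI allI impI)
  fix b x0 and l :: nat
  assume b: "b \<in> range (\<lambda>x. A *v x)" and l: "l \<ge> 1"
  let ?C = "inner_iter_precond M H l"
  have "M ** H = N"
    using assms(2,3) by (simp add: matrix_mul_assoc matrix_inv_mult)
  then have A: "A *v u = M *v (u - H *v u)" for u
    by (simp add: assms(1) matrix_vector_mult_diff_rdistrib matrix_vector_mult_diff_distrib
        matrix_vector_mul_assoc)
  have M0: "y = 0" if "M *v y = 0" for y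
    using that inj_matrix_vector_mult[OF assms(2)] by (metis injD matrix_vector_mult_0_right)
  show "gmres_determines_solution A ?C b x0"
  proof (rule gmres_determines_solution_if_inj_on_range[OF b])
    fix v assume "v \<in> range ((*v) A)" and ACv: "(A ** ?C) *v v = 0"
    then obtain z where v: "v = A *v z" by auto
    \<comment> \<open>With this choice \<open>v = M *v y\<close>, the form of argument that the
      telescoping identity expects, and \<open>y\<close> lies in the range of I - H, where powers of
      \<open>H\<close> tend to 0.\<close>
    define y where "y = z - H *v z"
    have "M *v (y - mat_power H l *v y) = 0"
      using ACv inner_iter_precond_telescope[OF assms(2) refl, of H l y]
      unfolding matrix_vector_mul_assoc[symmetric] v by (simp add: A y_def[symmetric])
    then have "mat_power H l *v y = y" using M0 by fastforce
    then have "y = 0" using semiconvergent_fixed_range_eq_0[OF assms(4) l y_def] by simp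
    then show "v = 0" by (simp add: v A y_def[symmetric])
  qed
qed

end
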